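(* Suppose that the matrices $\boldsymbol\Sigma_1,\dots,\boldsymbol\Sigma_T$ commute pairwise, and let $\boldsymbol U\in\mathbb R^{p\times p}$ be an orthogonal matrix with $\boldsymbol\Sigma_t=\boldsymbol U\,\mathrm{diag}\{\gamma_1^{(t)},\dots,\gamma_p^{(t)}\}\,\boldsymbol U^\top$ for every $t\in[T]$. Suppose also that $\sum_{t=1}^T\gamma_j^{(t)}>0$ for each $j\in[p]$. Then the estimation error of the oracle estimator is $$\mathcal L(\widehat{\boldsymbol w}_T^{(\mathrm{ORA})})=\sum_{j=1}^p\frac{\sigma^2}{\gamma_j^{(1)}n_1+\dots+\gamma_j^{(T)}n_T}.$$
   Context: Setting (continual linear regression). There are $T$ tasks. Task $t\in[T]=\{1,\dots,T\}$ has $n_t\ge1$ samples, a fixed (deterministic) design matrix $\boldsymbol X_t\in\mathbb R^{n_t\times p}$ and response vector $\boldsymbol y_t=\boldsymbol X_t\boldsymbol w_*+\boldsymbol\varepsilon_t\in\mathbb R^{n_t}$, where $\boldsymbol w_*\in\mathbb R^p$ is a fixed parameter common to all tasks, and the noise entries (over all samples and tasks) are independent with mean $0$ and variance $\sigma^2>0$. Put $\boldsymbol\Sigma_t=\boldsymbol X_t^\top\boldsymbol X_t/n_t\in\mathbb R^{p\times p}$. For an estimator $\widehat{\boldsymbol w}$, $\mathcal L(\widehat{\boldsymbol w})=\mathbb E\|\widehat{\boldsymbol w}-\boldsymbol w_*\|^2$ (Euclidean norm, expectation over the noise). Oracle estimator: $\widehat{\boldsymbol w}_T^{(\mathrm{ORA})}=\arg\min_{\boldsymbol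 w\in\mathbb R^p}\sum_{t=1}^T\|\boldsymbol X_t\boldsymbol w-\boldsymbol y_t\|^2$ (under the hypotheses of the claim the minimizer is unique). *)

theory Defs
  imports "HOL-Probability.Probability"
begin

text \<open>
  The number of samples \<open>m\<close> depends on the task, so an \<open>m \<times> p\<close> design matrix is given by its rows
  \<open>A 1, \<dots>, A m :: real ^ 'p\<close>, and \<open>(A w)\<^sub>i = A i \<bullet> w\<close>. Rows with index outside \<open>{1..m}\<close> are irrelevant.
\<close>

text \<open>\<open>A\<^sup>T A / m\<close>, entry by entry.\<close>
definition sample_covariance :: "nat \<Rightarrow> (nat \<Rightarrow> real ^ 'p) \<Rightarrow> real ^ 'p ^ 'p" where
  "sample_covariance m A = (\<chi> j k. (\<Sum>i=1..m. A i $ j * A i $ k) / real m)"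

definition diag_matrix :: "('p \<Rightarrow> real) \<Rightarrow> real ^ 'p ^ 'p" where
  "diag_matrix d = (\<chi> i j. if i = j then d i else 0)"

definition squared_residual :: "nat \<Rightarrow> (nat \<Rightarrow> real ^ 'p) \<Rightarrow> (nat \<Rightarrow> real) \<Rightarrow> real ^ 'p \<Rightarrow> real" where
  "squared_residual m A y w = (\<Sum>i=1..m. (A i \<bullet> w - y i)\<^sup>2)"

text \<open>\<open>arg_min\<close> picks some minimizer; it is determined only if the minimizer exists and is unique.\<close>
definition oracle_estimator ::
    "nat \<Rightarrow> (nat \<Rightarrow> nat) \<Rightarrow> (nat \<Rightarrow> nat \<Rightarrow> real ^ 'p) \<Rightarrow> (nat \<Rightarrow> nat \<Rightarrow> real) \<Rightarrow> real ^ 'p" where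
  "oracle_estimator T n X y =
     arg_min (\<lambda>w. \<Sum>t=1..T. squared_residual (n t) (X t) (y t) w) (\<lambda>w. True)"

definition response ::
    "(nat \<Rightarrow> nat \<Rightarrow> real ^ 'p) \<Rightarrow> real ^ 'p \<Rightarrow> (nat \<Rightarrow> nat \<Rightarrow> 'a \<Rightarrow> real) \<Rightarrow> 'a \<Rightarrow> nat \<Rightarrow> nat \<Rightarrow> real" where
  "response X w \<epsilon> \<omega> t i = X t i \<bullet> w + \<epsilon> t i \<omega>"

definition estimation_error :: "'a measure \<Rightarrow> real ^ 'p \<Rightarrow> ('a \<Rightarrow> real ^ 'p) \<Rightarrow> real" where
  "estimation_error M w west = (\<integral>\<omega>. (norm (west \<omega> - w))\<^sup>2 \<partial>M)"

end

theory Submission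
  imports Defs
begin

text \<open>
  Let \<open>u\<^sub>j\<close> be the columns of \<open>U\<close>, let \<open>a\<^sub>k\<close> run through the rows of all designs and put
  \<open>\<Lambda>\<^sub>j = (\<Sum>t. \<gamma>\<^sub>t\<^sub>j n\<^sub>t)\<close>. The simultaneous diagonalization says \<open>(\<Sum>k. (a\<^sub>k \<bullet> u\<^sub>i) (a\<^sub>k \<bullet> u\<^sub>j)) = \<Lambda>\<^sub>j\<close> if \<open>i = j\<close>,
  and \<open>0\<close> otherwise. So in the basis \<open>u\<close> the least squares problem splits into \<open>p\<close> scalar ones: the
  \<open>j\<close>-th coordinate of the error is \<open>(\<Sum>k. (a\<^sub>k \<bullet> u\<^sub>j) \<epsilon>\<^sub>k) / \<Lambda>\<^sub>j\<close>, whose second moment is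
  \<open>\<sigma>\<^sup>2 \<Lambda>\<^sub>j / \<Lambda>\<^sub>j\<^sup>2\<close>. Positivity of \<open>\<Lambda>\<^sub>j\<close> uses that every \<open>\<gamma>\<^sub>t\<^sub>j\<close> is nonnegative, because sample covariances
  are positive semidefinite.
\<close>

lemma inner_column_orthogonal_matrix:
  fixes U :: "real ^ 'p ^ 'p"
  assumes "orthogonal_matrix U"
  shows "column i U \<bullet> column j U = (if i = j then 1 else 0)"
  using assms by (auto simp: orthogonal_matrix_orthonormal_columns orthogonal_def norm_eq_1)

lemma orthogonal_matrix_expansion:
  fixes U :: "real ^ 'p ^ 'p"
  assumes "orthogonal_matrix U"
  shows "x = (\<Sum>j\<in>UNIV. (x \<bullet> column j U) *\<^sub>R column j U)"
proof -
  have comp: "(transpose U *v x) $ j = x \<bullet> column j U" for j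
    by (simp add: matrix_vector_mult_def transpose_def column_def inner_vec_def mult.commute)
  have "x = U *v (transpose U *v x)"
    using assms by (simp add: orthogonal_matrix_def matrix_vector_mul_assoc del: transpose_matrix_vector)
  also have "\<dots> = (\<Sum>j\<in>UNIV. (x \<bullet> column j U) *\<^sub>R column j U)"
    by (subst matrix_mult_sum) (simp add: comp scalar_mult_eq_scaleR del: transpose_matrix_vector)
  finally show ?thesis .
qed

lemma orthogonal_matrix_parseval:
  fixes U :: "real ^ 'p ^ 'p"
  assumes "orthogonal_matrix U"
  shows "x \<bullet> y = (\<Sum>j\<in>UNIV. (x \<bullet> column j U) * (y \<bullet> column j U))"
proof -
  have "x \<bullet> y = (\<Sum>j\<in>UNIV. (x \<bullet> column j U) *\<^sub>R column j U) \<bullet> y"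
    by (simp flip: orthogonal_matrix_expansion[OF assms])
  also have "\<dots> = (\<Sum>j\<in>UNIV. (x \<bullet> column j U) * (y \<bullet> column j U))"
    unfolding inner_sum_left inner_scaleR_left by (simp add: inner_commute)
  finally show ?thesis .
qed

text \<open>Because the columns are orthonormal, \<open>transpose U\<close> sends
  \<open>column j U\<close> to \<open>axis j 1\<close>. Moving the left factor \<open>U\<close>
  across the inner product does the same to \<open>column i U\<close>, which leaves a single entry
  of the diagonal matrix.\<close>

lemma bilinear_diag_matrix:
  fixes U :: "real ^ 'p ^ 'p"
  assumes "orthogonal_matrix U"
  shows "column i U \<bullet> ((U ** diag_matrix d ** transpose U) *v column j U) = (if i = j then d j else 0)"
proof -
  have tr: "transpose U *v column j U = axis j 1" for j
    using assms by (simp add: vec_eq_iff matrix_vector_mult_def transpose_def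
        inner_column_orthogonal_matrix[OF assms, unfolded inner_vec_def column_def, simplified]
        column_def axis_def)
  have "(U ** diag_matrix d ** transpose U) *v column j U = U *v (diag_matrix d *v axis j 1)"
    by (simp add: tr del: transpose_matrix_vector flip: matrix_vector_mul_assoc)
  then have "column i U \<bullet> ((U ** diag_matrix d ** transpose U) *v column j U)
      = axis i 1 \<bullet> (diag_matrix d *v axis j 1)"
    by (metis tr dot_lmul_matrix vector_transpose_matrix transpose_transpose)
  then show ?thesis
    by (simp add: inner_axis' matrix_vector_mult_basis column_def diag_matrix_def)
qed

text \<open>This is the bridge from the matrix hypotheses to sums over samples. For
  \<open>m = 0\<close> both sides are 0, as division by zero gives 0.\<close>

lemma bilinear_sample_covariance:
  "x \<bullet> (sample_covariance m A *v y) = (\<Sum>i=1..m. (A i \<bullet> x) * (A i \<bullet> y)) / real m"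
proof -
  have "x \<bullet> (sample_covariance m A *v y)
      = (\<Sum>j\<in>UNIV. \<Sum>k\<in>UNIV. \<Sum>i=1..m. (A i $ j * x $ j) * (A i $ k * y $ k) / real m)"
    by (simp add: sample_covariance_def inner_vec_def matrix_vector_mult_def sum_distrib_left
        sum_distrib_right sum_divide_distrib mult_ac)
  also have "\<dots> = (\<Sum>j\<in>UNIV. \<Sum>i=1..m. \<Sum>k\<in>UNIV. (A i $ j * x $ j) * (A i $ k * y $ k) / real m)"
    by (intro sum.cong refl sum.swap)
  also have "\<dots> = (\<Sum>i=1..m. \<Sum>j\<in>UNIV. \<Sum>k\<in>UNIV. (A i $ j * x $ j) * (A i $ k * y $ k) / real m)"
    by (rule sum.swap)
  also have "\<dots> = (\<Sum>i=1..m. (A i \<bullet> x) * (A i \<bullet> y)) / real m"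
    by (simp add: inner_vec_def sum_product sum_divide_distrib)
  finally show ?thesis .
qed

text \<open>A bilinear form is determined by its values on pairs of basis vectors: expand
  \<open>x\<close>, \<open>y\<close> in the columns of \<open>U\<close>, and the cross terms vanish
  by \<open>gram\<close>. The abstract index set lets all tasks be pooled.\<close>

lemma gram_form_diagonal:
  fixes U :: "real ^ 'p ^ 'p" and a :: "'k \<Rightarrow> real ^ 'p"
  assumes U: "orthogonal_matrix U"
    and gram: "\<And>i j. (\<Sum>k\<in>I. (a k \<bullet> column i U) * (a k \<bullet> column j U)) = (if i = j then \<Lambda> j else 0)"
  shows "(\<Sum>k\<in>I. (a k \<bullet> x) * (a k \<bullet> y))
      = (\<Sum>j\<in>UNIV. \<Lambda> j * (x \<bullet> column j U) * (y \<bullet> column j U))"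
proof -
  have "(\<Sum>k\<in>I. (a k \<bullet> x) * (a k \<bullet> y))
      = (\<Sum>k\<in>I. \<Sum>i\<in>UNIV. \<Sum>j\<in>UNIV. (x \<bullet> column i U) * (y \<bullet> column j U) *
          ((a k \<bullet> column i U) * (a k \<bullet> column j U)))"
    by (subst (1 2) orthogonal_matrix_parseval[OF U]) (simp add: sum_product mult_ac)
  also have "\<dots> = (\<Sum>i\<in>UNIV. \<Sum>k\<in>I. \<Sum>j\<in>UNIV. (x \<bullet> column i U) * (y \<bullet> column j U) *
          ((a k \<bullet> column i U) * (a k \<bullet> column j U)))"
    by (rule sum.swap)
  also have "\<dots> = (\<Sum>i\<in>UNIV. \<Sum>j\<in>UNIV. \<Sum>k\<in>I. (x \<bullet> column i U) * (y \<bullet> column j U) *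
          ((a k \<bullet> column i U) * (a k \<bullet> column j U)))"
    by (intro sum.cong refl sum.swap)
  also have "\<dots> = (\<Sum>i\<in>UNIV. \<Sum>j\<in>UNIV. if i = j then \<Lambda> j * (x \<bullet> column j U) * (y \<bullet> column j U) else 0)"
    by (intro sum.cong refl) (simp add: gram flip: sum_distrib_left)
  also have "\<dots> = (\<Sum>j\<in>UNIV. \<Lambda> j * (x \<bullet> column j U) * (y \<bullet> column j U))"
    by simp
  finally show ?thesis .
qed

text \<open>No derivatives are needed: \<open>w0 + ?h\<close> satisfies the normal equations, and
  completing the square around it leaves a positive definite form. This yields existence and
  uniqueness of the minimizer at once, so \<open>arg_min\<close> is determined.\<close>

lemma least_squares_error:
  fixes U :: "real ^ 'p ^ 'p" and a :: "'k \<Rightarrow> real ^ 'p"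
  assumes U: "orthogonal_matrix U"
    and gram: "\<And>i j. (\<Sum>k\<in>I. (a k \<bullet> column i U) * (a k \<bullet> column j U)) = (if i = j then \<Lambda> j else 0)"
    and pos: "\<And>j. \<Lambda> j > 0"
  shows "arg_min (\<lambda>w. \<Sum>k\<in>I. (a k \<bullet> w - (a k \<bullet> w0 + e k))\<^sup>2) (\<lambda>w. True) - w0
      = (\<Sum>j\<in>UNIV. ((\<Sum>k\<in>I. (a k \<bullet> column j U) * e k) / \<Lambda> j) *\<^sub>R column j U)"
    (is "arg_min ?f _ - w0 = ?h")
proof -
  have h: "?h \<bullet> column j U = (\<Sum>k\<in>I. (a k \<bullet> column j U) * e k) / \<Lambda> j" for j
    by (simp add: inner_sum_left inner_column_orthogonal_matrix[OF U] if_distrib cong: if_cong)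
  \<comment> \<open>The residual at \<open>w0 + ?h\<close> is \<open>a k \<bullet> ?h - e k\<close>.
    It is orthogonal to every direction \<open>d\<close> because the division by
    \<open>\<Lambda> j\<close> in \<open>?h\<close> cancels the weight \<open>\<Lambda> j\<close> of
    the Gram form.\<close>
  have normal_eq: "(\<Sum>k\<in>I. (a k \<bullet> d) * (a k \<bullet> ?h - e k)) = 0" for d
  proof -
    have "(\<Sum>k\<in>I. (a k \<bullet> d) * (a k \<bullet> ?h))
        = (\<Sum>j\<in>UNIV. \<Lambda> j * (d \<bullet> column j U) * (?h \<bullet> column j U))"
      by (rule gram_form_diagonal[OF U gram])
    also have "\<dots> = (\<Sum>j\<in>UNIV. \<Sum>k\<in>I. (d \<bullet> column j U) * (a k \<bullet> column j U) * e k)"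
      unfolding h
    proof (intro sum.cong refl)
      fix j
      show "\<Lambda> j * (d \<bullet> column j U) * ((\<Sum>k\<in>I. (a k \<bullet> column j U) * e k) / \<Lambda> j)
          = (\<Sum>k\<in>I. (d \<bullet> column j U) * (a k \<bullet> column j U) * e k)"
        using pos[of j] by (simp add: mult.assoc flip: sum_distrib_left)
    qed
    also have "\<dots> = (\<Sum>k\<in>I. \<Sum>j\<in>UNIV. (d \<bullet> column j U) * (a k \<bullet> column j U) * e k)"
      by (rule sum.swap)
    also have "\<dots> = (\<Sum>k\<in>I. (a k \<bullet> d) * e k)"
      by (subst orthogonal_matrix_parseval[OF U, of "a _" d]) (simp add: sum_distrib_left mult_ac)
    finally show ?thesis
      by (simp add: right_diff_distrib sum_subtractf)
  qed
  \<comment> \<open>Expand around \<open>w0 + ?h\<close>: the term linear in the displacement is the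
    one killed by \<open>normal_eq\<close>.\<close>
  have split: "?f w = ?f (w0 + ?h) + (\<Sum>j\<in>UNIV. \<Lambda> j * ((w - (w0 + ?h)) \<bullet> column j U)\<^sup>2)" for w
  proof -
    define d where "d = w - (w0 + ?h)"
    have w: "w = w0 + ?h + d"
      by (simp add: d_def)
    have "?f w = (\<Sum>k\<in>I. (a k \<bullet> (w0 + ?h) - (a k \<bullet> w0 + e k))\<^sup>2 + (a k \<bullet> d) * (a k \<bullet> d)
        + 2 * ((a k \<bullet> d) * (a k \<bullet> ?h - e k)))"
      unfolding w by (intro sum.cong refl) (simp add: inner_add_right power2_eq_square algebra_simps)
    also have "\<dots> = ?f (w0 + ?h) + (\<Sum>k\<in>I. (a k \<bullet> d) * (a k \<bullet> d))"
      unfolding sum.distrib sum_distrib_left[symmetric] normal_eq by simp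
    also have "(\<Sum>k\<in>I. (a k \<bullet> d) * (a k \<bullet> d)) = (\<Sum>j\<in>UNIV. \<Lambda> j * (d \<bullet> column j U)\<^sup>2)"
      by (simp add: gram_form_diagonal[OF U gram] power2_eq_square mult_ac)
    finally show ?thesis
      by (simp add: d_def)
  qed
  have nonneg: "0 \<le> (\<Sum>j\<in>UNIV. \<Lambda> j * ((w - (w0 + ?h)) \<bullet> column j U)\<^sup>2)" for w
    by (intro sum_nonneg mult_nonneg_nonneg less_imp_le[OF pos] zero_le_power2)
  let ?m = "arg_min ?f (\<lambda>w. True)"
  \<comment> \<open>At first only the minimal value is known, not the point chosen by
    \<open>arg_min\<close>. Equal values force the quadratic excess in \<open>split\<close> to
    vanish, hence every coordinate of the difference.\<close>
  have "?f ?m = ?f (w0 + ?h)"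
  proof (rule arg_min_equality)
    show "?f (w0 + ?h) \<le> ?f w" for w
      using split[of w] nonneg[of w] by linarith
  qed simp
  then have "(\<Sum>j\<in>UNIV. \<Lambda> j * ((?m - (w0 + ?h)) \<bullet> column j U)\<^sup>2) = 0"
    using split[of ?m] by linarith
  then have "(?m - (w0 + ?h)) \<bullet> column j U = 0" for j
    using pos[of j] by (subst (asm) sum_nonneg_eq_0_iff) (auto simp: less_imp_le[OF pos] dest!: spec[of _ j])
  then have "?m - (w0 + ?h) = 0"
    using orthogonal_matrix_expansion[OF U, of "?m - (w0 + ?h)"] by simp
  then show ?thesis
    by simp
qed

text \<open>Expand the square: by independence and zero mean the mixed products have expectation 0,
  so only the diagonal survives. Integrability is recorded too, since it is what allows such squares
  to be summed under the integral.\<close>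

lemma (in prob_space) square_sum_indep_vars:
  fixes e :: "'k \<Rightarrow> 'a \<Rightarrow> real"
  assumes I: "finite I" and ind: "indep_vars (\<lambda>_. borel) e I"
    and int: "\<And>k. k \<in> I \<Longrightarrow> integrable M (e k)"
    and int2: "\<And>k. k \<in> I \<Longrightarrow> integrable M (\<lambda>\<omega>. (e k \<omega>)\<^sup>2)"
    and mean: "\<And>k. k \<in> I \<Longrightarrow> expectation (e k) = 0"
    and second_moment: "\<And>k. k \<in> I \<Longrightarrow> expectation (\<lambda>\<omega>. (e k \<omega>)\<^sup>2) = s"
  shows integrable_square_sum_indep_vars: "integrable M (\<lambda>\<omega>. (\<Sum>k\<in>I. c k * e k \<omega>)\<^sup>2)"
    and expectation_square_sum_indep_vars:
      "expectation (\<lambda>\<omega>. (\<Sum>k\<in>I. c k * e k \<omega>)\<^sup>2) = s * (\<Sum>k\<in>I. (c k)\<^sup>2)"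
proof -
  have prod: "integrable M (\<lambda>\<omega>. e k \<omega> * e l \<omega>) \<and>
      expectation (\<lambda>\<omega>. e k \<omega> * e l \<omega>) = (if k = l then s else 0)" if "k \<in> I" "l \<in> I" for k l
  proof (cases "k = l")
    case True
    then show ?thesis
      using int2 second_moment that by (simp add: power2_eq_square)
  next
    case False
    have ind': "indep_vars (\<lambda>_. borel) e {k, l}"
      using ind that by (rule_tac indep_vars_subset) auto
    have "integrable M (\<lambda>\<omega>. \<Prod>i\<in>{k, l}. e i \<omega>)"
      by (rule indep_vars_integrable[OF _ ind']) (use int that in auto)
    moreover have "expectation (\<lambda>\<omega>. \<Prod>i\<in>{k, l}. e i \<omega>) = (\<Prod>i\<in>{k, l}. expectation (e i))"
      by (rule indep_vars_lebesgue_integral[OF _ ind']) (use int that in auto)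
    ultimately show ?thesis
      using False mean that by simp
  qed
  have eq: "(\<Sum>k\<in>I. c k * e k \<omega>)\<^sup>2 = (\<Sum>k\<in>I. \<Sum>l\<in>I. c k * c l * (e k \<omega> * e l \<omega>))" for \<omega>
    by (simp add: power2_eq_square sum_product mult_ac)
  show "integrable M (\<lambda>\<omega>. (\<Sum>k\<in>I. c k * e k \<omega>)\<^sup>2)"
    unfolding eq using prod by (intro Bochner_Integration.integrable_sum integrable_mult_right) auto
  have "expectation (\<lambda>\<omega>. (\<Sum>k\<in>I. c k * e k \<omega>)\<^sup>2)
      = (\<Sum>k\<in>I. \<Sum>l\<in>I. c k * c l * expectation (\<lambda>\<omega>. e k \<omega> * e l \<omega>))"
    unfolding eq using prod by (simp add: Bochner_Integration.integral_sum)
  also have "\<dots> = (\<Sum>k\<in>I. \<Sum>l\<in>I. if k = l then s * (c k)\<^sup>2 else 0)"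
    using prod by (intro sum.cong refl) (simp add: power2_eq_square)
  also have "\<dots> = s * (\<Sum>k\<in>I. (c k)\<^sup>2)"
    using I by (simp add: sum_distrib_left)
  finally show "expectation (\<lambda>\<omega>. (\<Sum>k\<in>I. c k * e k \<omega>)\<^sup>2) = s * (\<Sum>k\<in>I. (c k)\<^sup>2)" .
qed

theorem lemma4p1:
  fixes M :: "'a measure"
    and T :: nat
    and n :: "nat \<Rightarrow> nat"
    and X :: "nat \<Rightarrow> nat \<Rightarrow> real ^ 'p"
    and wstar :: "real ^ 'p"
    and \<epsilon> :: "nat \<Rightarrow> nat \<Rightarrow> 'a \<Rightarrow> real"
    and \<sigma> :: real
    and U :: "real ^ 'p ^ 'p"
    and \<gamma> :: "nat \<Rightarrow> 'p \<Rightarrow> real"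
  assumes "prob_space M"
    and "\<And>t. t \<in> {1..T} \<Longrightarrow> n t \<ge> 1"
    and "prob_space.indep_vars M (\<lambda>_. borel) (\<lambda>(t, i). \<epsilon> t i) (SIGMA t:{1..T}. {1..n t})"
    and "\<And>t i. t \<in> {1..T} \<Longrightarrow> i \<in> {1..n t} \<Longrightarrow> integrable M (\<epsilon> t i)"
    and "\<And>t i. t \<in> {1..T} \<Longrightarrow> i \<in> {1..n t} \<Longrightarrow> integrable M (\<lambda>\<omega>. (\<epsilon> t i \<omega>)\<^sup>2)"
    and "\<And>t i. t \<in> {1..T} \<Longrightarrow> i \<in> {1..n t} \<Longrightarrow> prob_space.expectation M (\<epsilon> t i) = 0"
    and "\<And>t i. t \<in> {1..T} \<Longrightarrow> i \<in> {1..n t} \<Longrightarrow> prob_space.variance M (\<epsilon> t i) = \<sigma>\<^sup>2"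
    and "\<sigma>\<^sup>2 > 0"
    and "\<And>s t. s \<in> {1..T} \<Longrightarrow> t \<in> {1..T} \<Longrightarrow>
           sample_covariance (n s) (X s) ** sample_covariance (n t) (X t)
             = sample_covariance (n t) (X t) ** sample_covariance (n s) (X s)"
    and "orthogonal_matrix U"
    and "\<And>t. t \<in> {1..T} \<Longrightarrow>
           sample_covariance (n t) (X t) = U ** diag_matrix (\<gamma> t) ** transpose U"
    and "\<And>j. (\<Sum>t=1..T. \<gamma> t j) > 0"
  shows "estimation_error M wstar (\<lambda>\<omega>. oracle_estimator T n X (response X wstar \<epsilon> \<omega>))
           = (\<Sum>j\<in>UNIV. \<sigma>\<^sup>2 / (\<Sum>t=1..T. \<gamma> t j * real (n t)))"
proof -
  interpret prob_space M
    by fact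
  note n_pos = assms(2) and U = assms(10) and diag = assms(11)
  \<comment> \<open>Indexing all samples by pairs (task, sample) turns the oracle objective into one
    ordinary least squares problem.\<close>
  define I where "I = (SIGMA t:{1..T}. {1..n t})"
  define a where "a = (\<lambda>(t, i). X t i)"
  define e where "e = (\<lambda>(t, i). \<epsilon> t i)"
  define \<Lambda> where "\<Lambda> j = (\<Sum>t=1..T. \<gamma> t j * real (n t))" for j
  have [simp]: "finite I"
    by (simp add: I_def)
  have sum_I: "(\<Sum>t=1..T. \<Sum>i=1..n t. g t i) = (\<Sum>(t, i)\<in>I. g t i)" for g :: "nat \<Rightarrow> nat \<Rightarrow> real"
    by (simp add: I_def sum.Sigma)

  have gram_task: "(\<Sum>i=1..n t. (X t i \<bullet> column j U) * (X t i \<bullet> column k U))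
      = (if j = k then \<gamma> t k * real (n t) else 0)" if t: "t \<in> {1..T}" for t j k
  proof -
    \<comment> \<open>The covariance form of one task on two columns is computed twice, from the
      samples and from the diagonalization.\<close>
    have "(\<Sum>i=1..n t. (X t i \<bullet> column j U) * (X t i \<bullet> column k U)) / real (n t)
        = (if j = k then \<gamma> t k else 0)"
      using bilinear_sample_covariance[of "column j U" "n t" "X t" "column k U"]
      by (simp add: diag[OF t] bilinear_diag_matrix[OF U])
    then show ?thesis
      using n_pos[OF t] by (simp add: field_simps split: if_splits)
  qed
  have gram: "(\<Sum>k\<in>I. (a k \<bullet> column i U) * (a k \<bullet> column j U)) = (if i = j then \<Lambda> j else 0)" for i j
  proof -
    have "(\<Sum>k\<in>I. (a k \<bullet> column i U) * (a k \<bullet> column j U))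
        = (\<Sum>t=1..T. \<Sum>k=1..n t. (X t k \<bullet> column i U) * (X t k \<bullet> column j U))"
      unfolding sum_I by (simp add: a_def case_prod_unfold)
    also have "\<dots> = (\<Sum>t=1..T. if i = j then \<gamma> t j * real (n t) else 0)"
      by (intro sum.cong refl gram_task)
    also have "\<dots> = (if i = j then \<Lambda> j else 0)"
      by (simp add: \<Lambda>_def)
    finally show ?thesis .
  qed
  have pos: "\<Lambda> j > 0" for j
  proof -
    \<comment> \<open>The hypothesis bounds the unweighted sum of eigenvalues; as these are
      nonnegative and \<open>n t \<ge> 1\<close>, the weights can only enlarge it.\<close>
    have "\<gamma> t j \<le> \<gamma> t j * real (n t)" if t: "t \<in> {1..T}" for t
    proof -
      \<comment> \<open>By \<open>gram_task\<close> with equal columns this product is a sum of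
        squares.\<close>
      have "0 \<le> \<gamma> t j * real (n t)"
        using gram_task[OF t, of j j] sum_nonneg[of "{1..n t}" "\<lambda>i. (X t i \<bullet> column j U) * (X t i \<bullet> column j U)"]
        by simp
      then have "0 \<le> \<gamma> t j"
        using n_pos[OF t] by (simp add: zero_le_mult_iff)
      then show ?thesis
        using n_pos[OF t] by (simp add: mult_le_cancel_left1)
    qed
    then have "(\<Sum>t=1..T. \<gamma> t j) \<le> \<Lambda> j"
      unfolding \<Lambda>_def by (rule sum_mono)
    then show ?thesis
      using assms(12)[of j] by linarith
  qed

  have error: "(norm (oracle_estimator T n X (response X wstar \<epsilon> \<omega>) - wstar))\<^sup>2
      = (\<Sum>j\<in>UNIV. (\<Sum>k\<in>I. (a k \<bullet> column j U) / \<Lambda> j * e k \<omega>)\<^sup>2)" for \<omega>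
  proof -
    let ?h = "\<Sum>j\<in>UNIV. ((\<Sum>k\<in>I. (a k \<bullet> column j U) * e k \<omega>) / \<Lambda> j) *\<^sub>R column j U"
    have "oracle_estimator T n X (response X wstar \<epsilon> \<omega>)
        = arg_min (\<lambda>w. \<Sum>k\<in>I. (a k \<bullet> w - (a k \<bullet> wstar + e k \<omega>))\<^sup>2) (\<lambda>w. True)"
      by (simp add: oracle_estimator_def squared_residual_def response_def sum_I[simplified]
          a_def e_def case_prod_unfold)
    then have "oracle_estimator T n X (response X wstar \<epsilon> \<omega>) - wstar = ?h"
      by (simp only: least_squares_error[OF U gram pos])
    \<comment> \<open>The factor \<open>1 / \<Lambda> j\<close> is absorbed into the coefficients,
      so that each coordinate is a linear combination of the noise variables.\<close>
    moreover have "?h \<bullet> column j U = (\<Sum>k\<in>I. (a k \<bullet> column j U) / \<Lambda> j * e k \<omega>)" for j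
      by (simp add: inner_sum_left inner_column_orthogonal_matrix[OF U] if_distrib sum_divide_distrib
          cong: if_cong)
    moreover have "(norm ?h)\<^sup>2 = (\<Sum>j\<in>UNIV. (?h \<bullet> column j U)\<^sup>2)"
      unfolding power2_norm_eq_inner
      using orthogonal_matrix_parseval[OF U, of ?h ?h] by (simp only: power2_eq_square)
    ultimately show ?thesis
      by (simp only:)
  qed

  have "indep_vars (\<lambda>_. borel) e I"
    using assms(3) by (simp add: I_def e_def)
  moreover have "integrable M (e k)" "integrable M (\<lambda>\<omega>. (e k \<omega>)\<^sup>2)" "expectation (e k) = 0"
      "expectation (\<lambda>\<omega>. (e k \<omega>)\<^sup>2) = \<sigma>\<^sup>2" if "k \<in> I" for k
    \<comment> \<open>As the mean is 0, the variance is the second moment.\<close>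
    using that assms(4-6) assms(7) by (force simp: I_def e_def)+
  ultimately have moments:
      "integrable M (\<lambda>\<omega>. (\<Sum>k\<in>I. c k * e k \<omega>)\<^sup>2)"
      "expectation (\<lambda>\<omega>. (\<Sum>k\<in>I. c k * e k \<omega>)\<^sup>2) = \<sigma>\<^sup>2 * (\<Sum>k\<in>I. (c k)\<^sup>2)" for c
    using square_sum_indep_vars[of I e "\<sigma>\<^sup>2" c] by auto

  have "estimation_error M wstar (\<lambda>\<omega>. oracle_estimator T n X (response X wstar \<epsilon> \<omega>))
      = (\<Sum>j\<in>UNIV. \<sigma>\<^sup>2 * (\<Sum>k\<in>I. ((a k \<bullet> column j U) / \<Lambda> j)\<^sup>2))"
    unfolding estimation_error_def error by (simp only: Bochner_Integration.integral_sum moments)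
  also have "\<dots> = (\<Sum>j\<in>UNIV. \<sigma>\<^sup>2 / \<Lambda> j)"
  proof (intro sum.cong refl)
    fix j
    \<comment> \<open>The diagonal case of \<open>gram\<close> evaluates the sum of squared
      coefficients, leaving one factor \<open>\<Lambda> j\<close> in the denominator.\<close>
    have "(\<Sum>k\<in>I. ((a k \<bullet> column j U) / \<Lambda> j)\<^sup>2) = \<Lambda> j / (\<Lambda> j)\<^sup>2"
      using gram[of j j] by (simp add: power_divide flip: sum_divide_distrib power2_eq_square)
    then show "\<sigma>\<^sup>2 * (\<Sum>k\<in>I. ((a k \<bullet> column j U) / \<Lambda> j)\<^sup>2) = \<sigma>\<^sup>2 / \<Lambda> j"
      using pos[of j] by (simp add: power2_eq_square)
  qed
  finally show ?thesis
    by (simp add: \<Lambda>_def)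
qed

end
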